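(* Let $b\ge 2$ be an integer and let $W$ be a non-negative random variable with $\mathbb{E}[W]=1$ whose distribution is not that of $W_{TC}$. Let $(Y_n)_{n\ge 1}$ be the Mandelbrot cascade martingale associated with $W$ and $b$. Let $q\ge 2$ be real. If $\mathbb{E}[W^q]=b^{q-1}$, then $$\lim_{n\to\infty}\frac{\log \mathbb{E}[Y_n^q]}{\log n}=1.$$
   Context: $W_{TC}$ denotes the random variable with $\mathbb{P}(W_{TC}=b)=b^{-1}$ and $\mathbb{P}(W_{TC}=0)=1-b^{-1}$. Let $W(j_1,\dots,j_m)$, for $m\ge 1$ and $j_1,\dots,j_m\in\{0,\dots,b-1\}$, be independent copies of $W$ indexed by all non-empty finite words over $\{0,\dots,b-1\}$. The Mandelbrot cascade martingale is $$Y_n = b^{-n}\sum_{j_1,\dots,j_n\in\{0,\dots,b-1\}} W(j_1)W(j_1,j_2)\cdots W(j_1,j_2,\dots,j_n),\qquad n\ge 1.$$ *)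

theory Defs
  imports "HOL-Probability.Probability"
begin

(* The law on the real line with mass 1/b at b and mass 1 - 1/b at 0. *)
definition W_TC_law :: "nat \<Rightarrow> real measure" where
  "W_TC_law b =
     distr (measure_pmf (bernoulli_pmf (1 / real b))) borel (\<lambda>s. if s then real b else 0)"

definition words :: "nat \<Rightarrow> nat \<Rightarrow> nat list set" where
  "words b n = {js. length js = n \<and> set js \<subseteq> {0..<b}}"

(* For a word js = [j1, ..., jn], the factor take m js is the prefix [j1, ..., jm]. *)
definition cascade :: "nat \<Rightarrow> (nat list \<Rightarrow> 'a \<Rightarrow> real) \<Rightarrow> nat \<Rightarrow> 'a \<Rightarrow> real" where
  "cascade b X n \<omega> = (\<Sum>js\<in>words b n. \<Prod>m=1..n. X (take m js) \<omega>) / real b ^ n"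

end

theory Submission
  imports Defs "HOL-Real_Asymp.Real_Asymp"
begin

text \<open>
  Why the theorem is true. Splitting the words of length \<open>n + 1\<close> by their first letter writes
  \<open>Y\<^sub>n\<^sub>+\<^sub>1 = b\<^sup>-\<^sup>1 (Z\<^sub>0 + \<dots> + Z\<^sub>b\<^sub>-\<^sub>1)\<close> with independent branches
  \<open>Z\<^sub>j\<close>, each distributed as \<open>W Y\<^sub>n\<close> with \<open>W\<close> and \<open>Y\<^sub>n\<close> independent. If the \<open>q\<close>-th power
  of the sum were the sum of the \<open>q\<close>-th powers, \<open>E[Y\<^sub>n\<^sub>+\<^sub>1 powr q]\<close> would be
  \<open>b powr (1 - q) * E[W powr q] * E[Y\<^sub>n powr q]\<close>, which at the critical value
  \<open>E[W powr q] = b powr (q - 1)\<close> is just \<open>E[Y\<^sub>n powr q]\<close>. So the increments of the \<open>q\<close>-th moment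
  are produced by the cross terms alone.

  For \<open>q \<ge> 2\<close> these cross terms are, up to constant factors in both directions, the sum over
  \<open>i \<noteq> j\<close> of \<open>Z\<^sub>i * Z\<^sub>j powr (q - 1)\<close> (lemmas \<open>powr_sum_le_cross\<close> and \<open>powr_sum_ge_cross\<close>).
  By independence and \<open>E[Z\<^sub>i] = 1\<close> their expectation is a multiple of \<open>E[Z\<^sub>j powr (q - 1)]\<close>, which
  is bounded below because \<open>Z\<^sub>j\<close> has mean 1. It is bounded above as soon as
  \<open>E[Y\<^sub>n powr (q - 1)]\<close> is bounded in \<open>n\<close>. For \<open>q = 2\<close> that moment is 1. For \<open>q > 2\<close> the exponent
  \<open>q - 1\<close> is strictly subcritical, \<open>E[W powr (q - 1)] < b powr (q - 2)\<close>: a weighted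
  arithmetic-geometric mean inequality applied to \<open>W / b\<close> gives \<open>\<le>\<close>, with equality only if
  \<open>W\<close> takes the values \<open>0\<close> and \<open>b\<close> alone, that is, for the excluded law
  (lemma \<open>moment_below_critical\<close>). At a subcritical exponent the same recursion is a contraction
  up to an additive constant, so the moments stay bounded (lemma \<open>moment_bounded_if_subcritical\<close>).

  The increments of \<open>E[Y\<^sub>n powr q]\<close> are therefore bounded above and bounded away from 0, and the
  moment grows linearly in \<open>n\<close> (lemma \<open>critical_moment_linear_growth\<close>).
\<close>

section \<open>Expanding a power of a sum\<close>

lemma powr_diff_le:
  fixes x y p :: real
  assumes "0 < x" "x \<le> y" "1 \<le> p"
  shows "y powr p - x powr p \<le> p * (y - x) * y powr (p - 1)"
proof (cases "x = y")
  case False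
  with assms have "x < y" by simp
  then obtain z where z: "x < z" "z < y" "y powr p - x powr p = (y - x) * (p * z powr (p - 1))"
    using MVT2[of x y "\<lambda>t. t powr p" "\<lambda>t. p * t powr (p - 1)"] assms
      has_real_derivative_powr[of _ p] by (metis order_less_le_trans)
  have "z powr (p - 1) \<le> y powr (p - 1)"
    using z assms by (intro powr_mono2) auto
  then have "(y - x) * (p * z powr (p - 1)) \<le> (y - x) * (p * y powr (p - 1))"
    using assms by (intro mult_left_mono) auto
  then show ?thesis unfolding z(3) by (simp add: mult_ac)
qed simp

text \<open>
  Let \<open>z m\<close> be the largest term. All the other terms together raise the power from
  \<open>z m powr p\<close> to the power of the sum, and by the mean value theorem this costs at most
  their sum times \<open>p\<close> times the \<open>(p - 1)\<close>-th power of the whole sum. As the whole sum is at most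
  \<open>card I\<close> times \<open>z m\<close>, the cost is controlled by the cross terms that contain
  \<open>z m powr (p - 1)\<close>.
\<close>

lemma powr_sum_le_cross:
  fixes z :: "'i \<Rightarrow> real"
  assumes I: "finite I" and z: "\<And>i. i \<in> I \<Longrightarrow> 0 \<le> z i" and p: "1 \<le> p"
  shows "(\<Sum>i\<in>I. z i) powr p
    \<le> (\<Sum>i\<in>I. z i powr p)
      + p * real (card I) powr (p - 1) * (\<Sum>j\<in>I. \<Sum>i\<in>I - {j}. z i * z j powr (p - 1))"
    (is "?S powr p \<le> ?D + ?c * ?R")
proof (cases "?S = 0")
  case True
  then have "?S powr p = 0" by simp
  moreover have "0 \<le> ?D" by (intro sum_nonneg) auto
  moreover have "0 \<le> ?R" using z by (intro sum_nonneg mult_nonneg_nonneg) auto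
  ultimately show ?thesis using p by simp
next
  case False
  then have "I \<noteq> {}" by auto
  obtain m where m: "m \<in> I" "Max (z ` I) = z m"
    using obtains_MAX[OF I \<open>I \<noteq> {}\<close>] by metis
  have max: "z i \<le> z m" if "i \<in> I" for i
    using m(2) that I by (metis Max_ge finite_imageI imageI)
  have zm: "0 < z m"
    using False max z m(1) by (metis order_antisym_conv not_le sum.neutral)
  have S_le: "?S \<le> real (card I) * z m"
    using sum_bounded_above[of I z "z m"] max by simp
  have m_le: "z m \<le> ?S" using m(1) I z by (intro member_le_sum) auto
  have "?S powr p \<le> z m powr p + p * (?S - z m) * ?S powr (p - 1)"
    using powr_diff_le[OF zm m_le p] by simp
  also have "?S powr (p - 1) \<le> (real (card I) * z m) powr (p - 1)"
    using S_le m_le zm p by (intro powr_mono2) auto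
  also have "\<dots> = real (card I) powr (p - 1) * z m powr (p - 1)"
    using zm by (simp add: powr_mult)
  also have "?S - z m = (\<Sum>i\<in>I - {m}. z i)"
    using I m(1) by (simp add: sum_diff1)
  also have "p * (\<Sum>i\<in>I - {m}. z i) * (real (card I) powr (p - 1) * z m powr (p - 1))
      = ?c * (\<Sum>i\<in>I - {m}. z i * z m powr (p - 1))"
    by (simp add: sum_distrib_right[symmetric])
  also have "(\<Sum>i\<in>I - {m}. z i * z m powr (p - 1)) \<le> ?R"
    using m(1) I z by (intro member_le_sum[of m I "\<lambda>j. \<Sum>i\<in>I - {j}. z i * z j powr (p - 1)"]
        sum_nonneg mult_nonneg_nonneg) auto
  also have "z m powr p \<le> ?D" using m(1) I by (intro member_le_sum) auto
  finally show ?thesis using p m_le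
    by (simp add: mult_left_mono mult_right_mono)
qed

lemma sum_powr_le_powr_sum:
  fixes z :: "'i \<Rightarrow> real"
  assumes I: "finite I" and z: "\<And>i. i \<in> I \<Longrightarrow> 0 \<le> z i" and p: "1 \<le> p"
  shows "(\<Sum>i\<in>I. z i powr p) \<le> (\<Sum>i\<in>I. z i) powr p"
proof -
  have split: "x powr p = x * x powr (p - 1)" if "0 \<le> x" for x :: real
    using that by (cases "x = 0") (auto simp: powr_diff)
  have "(\<Sum>i\<in>I. z i powr p) \<le> (\<Sum>i\<in>I. z i * (\<Sum>i\<in>I. z i) powr (p - 1))"
    using I z p by (intro sum_mono) (auto simp: split intro!: mult_left_mono powr_mono2 member_le_sum)
  also have "\<dots> = (\<Sum>i\<in>I. z i) powr p"
    using z by (simp add: split sum_nonneg sum_distrib_right)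
  finally show ?thesis .
qed

text \<open>
  One factor of the power is multiplied out; the remaining power \<open>p - 1 \<ge> 1\<close> is superadditive,
  which is where \<open>p \<ge> 2\<close> enters.
\<close>

lemma powr_sum_ge_cross:
  fixes z :: "'i \<Rightarrow> real"
  assumes I: "finite I" and z: "\<And>i. i \<in> I \<Longrightarrow> 0 \<le> z i" and p: "2 \<le> p"
  shows "(\<Sum>i\<in>I. z i powr p) + (\<Sum>j\<in>I. \<Sum>i\<in>I - {j}. z i * z j powr (p - 1))
    \<le> (\<Sum>i\<in>I. z i) powr p"
proof -
  have split: "x powr p = x * x powr (p - 1)" if "0 \<le> x" for x :: real
    using that by (cases "x = 0") (auto simp: powr_diff)
  have "(\<Sum>i\<in>I. z i powr p) + (\<Sum>j\<in>I. \<Sum>i\<in>I - {j}. z i * z j powr (p - 1))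
      = (\<Sum>j\<in>I. (z j + (\<Sum>i\<in>I - {j}. z i)) * z j powr (p - 1))"
    using z by (simp add: split sum.distrib[symmetric] sum_distrib_right distrib_right)
  also have "\<dots> = (\<Sum>j\<in>I. (\<Sum>i\<in>I. z i) * z j powr (p - 1))"
    using I by (intro sum.cong refl) (simp add: sum.remove[symmetric])
  also have "\<dots> = (\<Sum>i\<in>I. z i) * (\<Sum>j\<in>I. z j powr (p - 1))"
    by (simp add: sum_distrib_left)
  also have "\<dots> \<le> (\<Sum>i\<in>I. z i) * (\<Sum>i\<in>I. z i) powr (p - 1)"
    using I z p by (intro mult_left_mono sum_powr_le_powr_sum sum_nonneg) auto
  also have "\<dots> = (\<Sum>i\<in>I. z i) powr p"
    using z by (simp add: split sum_nonneg)
  finally show ?thesis .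
qed

text \<open>
  A form of Young's inequality: it trades the \<open>(s - 1)\<close>-th moment in the cross terms for an
  arbitrarily small multiple of the \<open>s\<close>-th moment and a constant. The two summands dominate on
  either side of \<open>y = 1 / \<delta>\<close>.
\<close>

lemma powr_le_add_powr:
  fixes y s t \<delta> :: real
  assumes "0 \<le> y" "0 < \<delta>" "1 \<le> s"
  shows "y powr (s - 1) \<le> \<delta> * y powr s + (1 / \<delta>) powr (s - 1)"
proof (cases "y \<le> 1 / \<delta>")
  case True
  then have "y powr (s - 1) \<le> (1 / \<delta>) powr (s - 1)"
    using assms by (intro powr_mono2) auto
  then show ?thesis using assms by (simp add: add_increasing)
next
  case False
  then have "1 \<le> \<delta> * y" "0 < y" using assms by (auto simp: field_simps intro: less_trans[of 0 "1/\<delta>"])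
  then have "1 * y powr (s - 1) \<le> \<delta> * y * y powr (s - 1)"
    by (intro mult_right_mono) auto
  also have "\<dots> = \<delta> * y powr s" using \<open>0 < y\<close> by (simp add: powr_diff)
  finally show ?thesis by (simp add: add_increasing2)
qed

text \<open>
  Integrated, this shows that a non-negative variable of mean 1 has \<open>p\<close>-th moment at least
  \<open>2 powr (- p)\<close>. It stands in for the sharp bound 1 of Jensen's inequality, as only positivity
  of the bound matters.
\<close>

lemma le_half_add_powr:
  fixes z p :: real
  assumes "0 \<le> z" "1 \<le> p"
  shows "z \<le> 1 / 2 + 2 powr (p - 1) * z powr p"
proof (cases "z \<le> 1 / 2")
  case False
  then have "1 \<le> (2 * z) powr (p - 1)"
    using assms by (intro ge_one_powr_ge_zero) auto
  then have "z * 1 \<le> z * (2 * z) powr (p - 1)"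
    using assms by (intro mult_left_mono) auto
  also have "\<dots> = 2 powr (p - 1) * z powr p"
    using assms False by (simp add: powr_mult powr_diff)
  finally show ?thesis by simp
qed (simp add: add_increasing2)

section \<open>The moment below the critical one\<close>

text \<open>
  The weights are those that express \<open>q - 1\<close> as a convex combination of the exponents 1 and \<open>q\<close>.
  After division by \<open>t powr (q - 1)\<close> both terms on the right are exponentials whose exponents have
  weighted mean 0, and \<open>exp u > 1 + u\<close> for \<open>u \<noteq> 0\<close> gives strictness.
\<close>

lemma strict_weighted_am_gm:
  fixes t q :: real
  assumes t: "0 < t" "t \<noteq> 1" and q: "2 < q"
  shows "t powr (q - 1) < (1 / (q - 1)) * t + (1 - 1 / (q - 1)) * t powr q"
proof -
  define \<theta> where "\<theta> = 1 / (q - 1)"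
  have \<theta>: "0 < \<theta>" "\<theta> < 1" using q by (auto simp: \<theta>_def)
  define x where "x = ln t"
  have x: "x \<noteq> 0" using t by (simp add: x_def)
  have gt: "1 + u < exp u" if "u \<noteq> 0" for u :: real
    using that exp_ge_add_one_self[of u] ln_eq_minus_one[of "exp u"]
    by (smt (verit) exp_gt_zero ln_exp)
  have "\<theta> * (q - 2) = 1 - \<theta>"
    using q by (simp add: \<theta>_def field_simps)
  then have "1 = \<theta> * (1 + (2 - q) * x) + (1 - \<theta>) * (1 + x)"
    by algebra
  also have "\<dots> < \<theta> * exp ((2 - q) * x) + (1 - \<theta>) * exp x"
    using \<theta> q x by (intro add_strict_mono mult_strict_left_mono gt) auto
  finally have "1 < \<theta> * exp ((2 - q) * x) + (1 - \<theta>) * exp x" .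
  then have "t powr (q - 1) * 1 < t powr (q - 1) * (\<theta> * exp ((2 - q) * x) + (1 - \<theta>) * exp x)"
    using t by (intro mult_strict_left_mono) auto
  also have "\<dots> = \<theta> * (t powr (q - 1) * t powr (2 - q)) + (1 - \<theta>) * (t powr (q - 1) * t)"
    using t by (simp add: x_def powr_def algebra_simps)
  also have "t powr (q - 1) * t powr (2 - q) = t"
    using t by (simp add: powr_add[symmetric])
  also have "t powr (q - 1) * t = t powr q"
    using t by (simp add: powr_diff)
  finally show ?thesis by (simp add: \<theta>_def)
qed

text \<open>
  The mean fixes the probability of the value \<open>b\<close>, so there is only one law of mean 1 on
  \<open>0\<close> and \<open>b\<close>. The variable is factored through the event \<open>W = b\<close> because two measures on the
  finite type \<open>bool\<close> can be compared point by point.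
\<close>

lemma (in prob_space) two_point_law_eq_W_TC_law:
  assumes b: "0 < b" and W: "W \<in> borel_measurable M"
    and two: "AE \<omega> in M. W \<omega> = 0 \<or> W \<omega> = real b"
    and mean: "expectation W = 1"
  shows "distr M borel W = W_TC_law b"
proof -
  define s where "s \<omega> \<longleftrightarrow> W \<omega> = real b" for \<omega>
  define f where "f = (\<lambda>s. if s then real b else 0)"
  have s[measurable]: "s \<in> measurable M (count_space UNIV)"
    unfolding s_def using W by measurable
  have Wf: "AE \<omega> in M. W \<omega> = f (s \<omega>)"
    using two by eventually_elim (auto simp: f_def s_def)
  define A where "A = {\<omega> \<in> space M. s \<omega>}"
  have A[measurable]: "A \<in> events" unfolding A_def by measurable
  have "1 = expectation (\<lambda>\<omega>. real b * indicator A \<omega>)"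
    unfolding mean[symmetric] using Wf W
    by (intro integral_cong_AE) (auto simp: f_def A_def split: split_indicator if_splits)
  then have "prob A = 1 / real b" using b by (simp add: field_simps)
  then have True: "prob (s -` {True} \<inter> space M) = 1 / real b"
    by (simp add: A_def vimage_def Int_def conj_commute)
  have "prob (s -` {False} \<inter> space M) = prob (space M - A)"
    by (rule arg_cong[where f=prob]) (auto simp: A_def)
  also have "\<dots> = 1 - 1 / real b"
    using prob_compl[OF A] \<open>prob A = _\<close> by simp
  finally have False: "prob (s -` {False} \<inter> space M) = 1 - 1 / real b" .
  have "distr M (count_space UNIV) s = measure_pmf (bernoulli_pmf (1 / real b))"
  proof (rule measure_eqI_finite[where A=UNIV])
    fix a :: bool
    show "emeasure (distr M (count_space UNIV) s) {a} = emeasure (measure_pmf (bernoulli_pmf (1 / real b))) {a}"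
      using b True False
      by (cases a) (auto simp: emeasure_distr emeasure_eq_measure emeasure_pmf_single)
  qed auto
  moreover have "distr M borel W = distr M borel (f \<circ> s)"
    using Wf W by (intro distr_cong_AE) (auto simp: comp_def)
  moreover have "distr M borel (f \<circ> s) = distr (distr M (count_space UNIV) s) borel f"
    by (subst distr_distr) auto
  ultimately show ?thesis
    by (simp add: W_TC_law_def f_def)
qed

text \<open>
  At \<open>t = W / b\<close> the two outer expectations in the weighted inequality coincide:
  \<open>E[t] = E[t powr q] = 1 / b\<close>. Hence \<open>E[t powr (q - 1)] \<le> 1 / b\<close>, and equality forces the
  non-negative gap \<open>h t\<close> to vanish almost surely, so that \<open>t\<close> is 0 or 1.
\<close>

lemma (in prob_space) moment_below_critical:
  assumes b: "0 < b" and W[measurable]: "W \<in> borel_measurable M"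
    and nonneg: "AE \<omega> in M. 0 \<le> W \<omega>" and mean: "expectation W = 1"
    and not_TC: "distr M borel W \<noteq> W_TC_law b"
    and q: "2 < q" and critical: "expectation (\<lambda>\<omega>. W \<omega> powr q) = real b powr (q - 1)"
  shows "expectation (\<lambda>\<omega>. W \<omega> powr (q - 1)) < real b powr (q - 2)"
proof (rule ccontr)
  assume "\<not> ?thesis"
  then have ge: "real b powr (q - 2) \<le> expectation (\<lambda>\<omega>. W \<omega> powr (q - 1))" by simp
  define B where "B = real b"
  have B: "0 < B" using b by (simp add: B_def)
  define \<theta> where "\<theta> = 1 / (q - 1)"
  define h where "h t = \<theta> * t + (1 - \<theta>) * t powr q - t powr (q - 1)" for t :: real
  have h_pos: "0 < h t" if "0 < t" "t \<noteq> 1" for t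
    using strict_weighted_am_gm[OF that q] by (simp add: h_def \<theta>_def)
  have h_nonneg: "0 \<le> h t" if "0 \<le> t" for t
    using that h_pos[of t] by (cases "t = 0 \<or> t = 1") (auto simp: h_def)
  have int1: "integrable M W"
    using mean not_integrable_integral_eq by fastforce
  have intq: "integrable M (\<lambda>\<omega>. W \<omega> powr q)"
    using critical b not_integrable_integral_eq by fastforce
  \<comment> \<open>the integral of a non-integrable function is 0 by convention, which the positive value rules out\<close>
  have int': "integrable M (\<lambda>\<omega>. W \<omega> powr (q - 1))"
    using ge b not_integrable_integral_eq[of M "\<lambda>\<omega>. W \<omega> powr (q - 1)"]
    by (metis not_le of_nat_0_less_iff powr_gt_zero order_less_irrefl)
  have h_eq: "h (W \<omega> / B) = \<theta> / B * W \<omega> + (1 - \<theta>) / B powr q * W \<omega> powr q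
      - W \<omega> powr (q - 1) / B powr (q - 1)" if "0 \<le> W \<omega>" for \<omega>
    using that B by (simp add: h_def powr_divide)
  define g where "g \<omega> = \<theta> / B * W \<omega> + (1 - \<theta>) / B powr q * W \<omega> powr q
      - W \<omega> powr (q - 1) / B powr (q - 1)" for \<omega>
  have g_int: "integrable M g"
    unfolding g_def using int1 intq int' by auto
  have g_nonneg: "AE \<omega> in M. 0 \<le> g \<omega>"
    using nonneg
  proof eventually_elim
    case (elim \<omega>)
    then show ?case
      using h_nonneg[of "W \<omega> / B"] h_eq[OF elim] B by (simp add: g_def)
  qed
  have "expectation g = \<theta> / B + (1 - \<theta>) / B powr q * B powr (q - 1)
      - expectation (\<lambda>\<omega>. W \<omega> powr (q - 1)) / B powr (q - 1)"
    unfolding g_def using int1 intq int' mean critical by (simp add: B_def)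
  also have "\<dots> \<le> \<theta> / B + (1 - \<theta>) / B powr q * B powr (q - 1) - B powr (q - 2) / B powr (q - 1)"
    using ge B by (intro diff_left_mono divide_right_mono) (auto simp: B_def)
  also have "B powr (q - 2) / B powr (q - 1) = 1 / B"
    using B by (simp add: powr_diff[symmetric] powr_minus_divide)
  also have "(1 - \<theta>) / B powr q * B powr (q - 1) = (1 - \<theta>) / B"
    using B by (simp add: powr_diff)
  also have "\<theta> / B + (1 - \<theta>) / B - 1 / B = 0"
    by (simp add: add_divide_distrib[symmetric] diff_divide_distrib[symmetric])
  finally have "expectation g = 0"
    using integral_nonneg_AE[OF g_nonneg] by simp
  then have "AE \<omega> in M. g \<omega> = 0"
    using integral_nonneg_eq_0_iff_AE[OF g_int g_nonneg] by simp
  with nonneg have "AE \<omega> in M. W \<omega> = 0 \<or> W \<omega> = real b"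
  proof eventually_elim
    case (elim \<omega>)
    then have "h (W \<omega> / B) = 0" using h_eq by (simp add: g_def)
    then have "\<not> 0 < W \<omega> / B \<or> W \<omega> / B = 1" using h_pos by force
    then show ?case using elim B by (auto simp: B_def zero_less_divide_iff)
  qed
  from two_point_law_eq_W_TC_law[OF b W this mean] not_TC show False by simp
qed

section \<open>The branching recursion\<close>

lemma finite_words [simp]: "finite (words b n)"
  unfolding words_def using finite_lists_length_eq[of "{0..<b}" n] by (simp add: conj_commute)

lemma words_0 [simp]: "words b 0 = {[]}"
  by (auto simp: words_def)

lemma words_Suc: "words b (Suc n) = (\<lambda>(j, js). j # js) ` ({0..<b} \<times> words b n)"
  by (force simp: words_def length_Suc_conv image_iff)

lemma Cons_in_words: "j < b \<Longrightarrow> js \<in> words b n \<Longrightarrow> j # js \<in> words b (Suc n)"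
  by (auto simp: words_def)

lemma take_in_words: "js \<in> words b n \<Longrightarrow> m \<le> n \<Longrightarrow> take m js \<in> words b m"
  using set_take_subset[of m js] by (auto simp: words_def)

lemma cascade_0 [simp]: "cascade b X 0 = (\<lambda>\<omega>. 1)"
  by (simp add: cascade_def fun_eq_iff)

lemma cascade_Suc:
  "cascade b X (Suc n) \<omega>
    = (\<Sum>j<b. X [j] \<omega> * cascade b (\<lambda>js. X (j # js)) n \<omega>) / real b"
proof -
  have prod: "(\<Prod>m=1..Suc n. X (take m (j # js)) \<omega>)
      = X [j] \<omega> * (\<Prod>m=1..n. X (j # take m js) \<omega>)" for j js
    by (subst prod.atLeast_Suc_atMost) (simp_all add: prod.shift_bounds_cl_Suc_ivl del: prod.cl_ivl_Suc)
  have "(\<Sum>js\<in>words b (Suc n). \<Prod>m=1..Suc n. X (take m js) \<omega>)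
      = (\<Sum>(j, js)\<in>{0..<b} \<times> words b n. \<Prod>m=1..Suc n. X (take m (j # js)) \<omega>)"
    unfolding words_Suc
    by (subst sum.reindex) (auto simp: inj_on_def case_prod_unfold comp_def simp del: prod.cl_ivl_Suc)
  also have "\<dots> = (\<Sum>j<b. X [j] \<omega> * (\<Sum>js\<in>words b n. \<Prod>m=1..n. X (j # take m js) \<omega>))"
    unfolding prod by (simp add: sum.cartesian_product[symmetric] sum_distrib_left atLeast0LessThan)
  finally show ?thesis
    by (simp add: cascade_def sum_divide_distrib[symmetric] mult.commute)
qed

text \<open>
  The two sample points may lie in different spaces; this lets one compare a cascade on the
  original space with a cascade of coordinates on a space of weight configurations.
\<close>

lemma cascade_cong:
  assumes "\<And>m js. 1 \<le> m \<Longrightarrow> m \<le> n \<Longrightarrow> js \<in> words b m \<Longrightarrow> X js \<omega> = X' js \<omega>'"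
  shows "cascade b X n \<omega> = cascade b X' n \<omega>'"
  unfolding cascade_def
  using assms by (intro arg_cong2[where f="(/)"] sum.cong prod.cong refl) (auto intro: take_in_words)

text \<open>
  Non-negativity is required at every sample point, so that the algebra of powers holds without
  exceptional null sets. Almost surely non-negative weights are covered by replacing them with
  their positive parts.
\<close>

locale nonneg_cascade = prob_space M
  for M :: "'b measure" and b :: nat and X :: "nat list \<Rightarrow> 'b \<Rightarrow> real" +
  assumes b: "2 \<le> b"
    and indep: "indep_vars (\<lambda>_. borel) X (\<Union>m\<in>{1..}. words b m)"
    and law: "\<And>m js. 1 \<le> m \<Longrightarrow> js \<in> words b m \<Longrightarrow> distr M borel (X js) = distr M borel (X [0])"
    and nonneg: "\<And>js \<omega>. 0 \<le> X js \<omega>"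
    and mean: "expectation (X [0]) = 1"
begin

definition proper_words :: "nat \<Rightarrow> nat list set" where
  "proper_words n = (\<Union>m\<in>{1..n}. words b m)"

definition subcascade :: "nat \<Rightarrow> nat \<Rightarrow> 'b \<Rightarrow> real" where
  "subcascade j = cascade b (\<lambda>js. X (j # js))"

text \<open>
  The cascade of depth \<open>n\<close> is a fixed function, namely the cascade of the coordinate maps, of the
  weights at the non-empty words of length at most \<open>n\<close>. Laws and independence of cascades are
  read off from those of the weights through this factorisation.
\<close>

lemma cascade_factors:
  "cascade b X' n \<omega> = cascade b (\<lambda>js f. f js) n (\<lambda>js\<in>proper_words n. X' js \<omega>)"
  by (intro cascade_cong) (auto simp: proper_words_def)

lemma measurable_evaluation_cascade:
  assumes "g ` proper_words n \<subseteq> K"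
  shows "cascade b (\<lambda>js f. f (g js)) n \<in> borel_measurable (Pi\<^sub>M K (\<lambda>_. borel))"
proof -
  have "take m js \<in> proper_words n" if "js \<in> words b n" "m \<in> {1..n}" for m js
    using that by (auto simp: proper_words_def intro!: bexI[of _ m] take_in_words)
  with assms show ?thesis
    unfolding cascade_def
    by (intro borel_measurable_divide borel_measurable_sum borel_measurable_prod
        measurable_component_singleton) auto
qed

lemma X_measurable: "1 \<le> m \<Longrightarrow> js \<in> words b m \<Longrightarrow> X js \<in> borel_measurable M"
  using indep by (auto simp: indep_vars_def)

lemma single_measurable [measurable]: "j < b \<Longrightarrow> X [j] \<in> borel_measurable M"
  by (rule X_measurable[of 1]) (auto simp: words_def)

lemma indep_reindex:
  assumes "inj_on f I" "f ` I \<subseteq> (\<Union>m\<in>{1..}. words b m)"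
  shows "indep_vars (\<lambda>_. borel) (\<lambda>i. X (f i)) I"
proof -
  have "indep_vars (\<lambda>i. Pi\<^sub>M {f i} (\<lambda>_. borel)) (\<lambda>i \<omega>. \<lambda>js\<in>{f i}. X js \<omega>) I"
    using assms by (intro indep_vars_restrict[OF indep]) (auto simp: disjoint_family_on_def inj_on_def)
  from indep_vars_compose2[OF this, of "\<lambda>i g. g (f i)" "\<lambda>_. borel"] show ?thesis by simp
qed

text \<open>
  The right-hand side does not depend on the relabelling \<open>f\<close>: the joint law of independent and
  identically distributed weights is the same product measure under every injective relabelling.
\<close>

lemma distr_cascade_relabelled:
  assumes f: "inj_on f (proper_words n)"
    and words: "\<And>js. js \<in> proper_words n \<Longrightarrow> f js \<in> (\<Union>m\<in>{1..}. words b m)"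
  shows "distr M borel (cascade b (\<lambda>js. X (f js)) n)
    = distr (Pi\<^sub>M (proper_words n) (\<lambda>_. distr M borel (X [0]))) borel (cascade b (\<lambda>js f. f js) n)"
proof (cases "proper_words n = {}")
  case True
  then have "n = 0"
    using b Cons_in_words[of 0 b "[]" 0] by (force simp: proper_words_def)
  interpret P: prob_space "Pi\<^sub>M {} (\<lambda>_::nat list. distr M borel (X [0]))"
    by (intro prob_space_PiM) auto
  show ?thesis
    using \<open>n = 0\<close> True P.prob_space_axioms
    by (simp add: prob_space.distr_const prob_space_axioms del: PiM_empty)
next
  case False
  let ?P = "Pi\<^sub>M (proper_words n) (\<lambda>_. borel) :: (nat list \<Rightarrow> real) measure"
  let ?J = "\<lambda>\<omega>. \<lambda>js\<in>proper_words n. X (f js) \<omega>"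
  have rv: "X (f js) \<in> borel_measurable M" if "js \<in> proper_words n" for js
    using words[OF that] X_measurable by auto
  have J[measurable]: "?J \<in> measurable M ?P"
    by (intro measurable_restrict rv)
  have law': "distr M borel (X (f js)) = distr M borel (X [0])" if "js \<in> proper_words n" for js
    using words[OF that] law by auto
  have "indep_vars (\<lambda>_. borel) (\<lambda>js. X (f js)) (proper_words n)"
    using f words by (intro indep_reindex) auto
  then have joint: "distr M ?P ?J = Pi\<^sub>M (proper_words n) (\<lambda>_. distr M borel (X [0]))"
    using indep_vars_iff_distr_eq_PiM'[OF False, where M'="\<lambda>_. borel" and X="\<lambda>js. X (f js)"] rv law'
    by (simp cong: PiM_cong)
  have "cascade b (\<lambda>js f. f js) n \<in> borel_measurable ?P"
    by (rule measurable_evaluation_cascade) auto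
  then have "distr (distr M ?P ?J) borel (cascade b (\<lambda>js f. f js) n)
      = distr M borel (cascade b (\<lambda>js f. f js) n \<circ> ?J)"
    by (intro distr_distr J)
  then show ?thesis
    unfolding joint cascade_factors[of "\<lambda>js. X (f js)" n, abs_def] by (simp add: comp_def)
qed

lemma distr_subcascade:
  assumes "j < b"
  shows "distr M borel (subcascade j n) = distr M borel (cascade b X n)"
proof -
  have "distr M borel (cascade b (\<lambda>js. X (j # js)) n) = distr M borel (cascade b (\<lambda>js. X (id js)) n)"
    using assms by (subst (1 2) distr_cascade_relabelled)
      (auto simp: proper_words_def inj_on_def intro: Cons_in_words)
  then show ?thesis by (simp add: subcascade_def)
qed


lemma cascade_nonneg: "0 \<le> cascade b X n \<omega>"
  unfolding cascade_def by (intro divide_nonneg_nonneg sum_nonneg prod_nonneg ballI nonneg) auto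

lemma subcascade_nonneg: "0 \<le> subcascade j n \<omega>"
  unfolding subcascade_def cascade_def
  by (intro divide_nonneg_nonneg sum_nonneg prod_nonneg ballI nonneg) auto

definition branch :: "nat \<Rightarrow> nat \<Rightarrow> 'b \<Rightarrow> real" where
  "branch j n \<omega> = X [j] \<omega> * subcascade j n \<omega>"

lemma branch_nonneg: "0 \<le> branch j n \<omega>"
  by (simp add: branch_def nonneg subcascade_nonneg)

lemma cascade_Suc_branch: "cascade b X (Suc n) \<omega> = (\<Sum>j<b. branch j n \<omega>) / real b"
  by (simp add: cascade_Suc branch_def subcascade_def)

definition branch_words :: "nat \<Rightarrow> nat \<Rightarrow> nat list set" where
  "branch_words j n = (#) j ` proper_words n"

lemma branch_words_subset: "j < b \<Longrightarrow> branch_words j n \<subseteq> (\<Union>m\<in>{1..}. words b m)"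
  by (fastforce simp: branch_words_def proper_words_def intro: Cons_in_words)

lemma single_in_words: "j < b \<Longrightarrow> [j] \<in> (\<Union>m\<in>{1..}. words b m)"
  by (auto simp: words_def)

lemma subcascade_factors:
  assumes "branch_words j n \<subseteq> K"
  shows "subcascade j n \<omega> = cascade b (\<lambda>js f. f (j # js)) n (\<lambda>js\<in>K. X js \<omega>)"
  unfolding subcascade_def
proof (intro cascade_cong)
  fix m js assume "1 \<le> m" "m \<le> n" "js \<in> words b m"
  then have "j # js \<in> branch_words j n"
    unfolding branch_words_def proper_words_def by (intro imageI) auto
  with assms show "X (j # js) \<omega> = (\<lambda>js\<in>K. X js \<omega>) (j # js)"
    by auto
qed

text \<open>
  The weight at \<open>[j]\<close> and the cascade below \<open>j\<close> use disjoint sets of words: the words of the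
  latter are \<open>j\<close> followed by a non-empty word.
\<close>

lemma indep_weight_subcascade:
  assumes "j < b"
  shows "indep_var borel (X [j]) borel (subcascade j n)"
proof -
  have "[] \<notin> proper_words n"
    by (auto simp: proper_words_def words_def)
  then have "indep_var (Pi\<^sub>M {[j]} (\<lambda>_. borel)) (\<lambda>\<omega>. \<lambda>js\<in>{[j]}. X js \<omega>)
      (Pi\<^sub>M (branch_words j n) (\<lambda>_. borel)) (\<lambda>\<omega>. \<lambda>js\<in>branch_words j n. X js \<omega>)"
    using branch_words_subset[OF assms, of n] single_in_words[OF assms]
    by (intro indep_var_restrict[OF indep]) (auto simp: branch_words_def)
  from indep_var_compose[OF this, of "\<lambda>f. f [j]" borel "cascade b (\<lambda>js f. f (j # js)) n" borel]
  have "indep_var borel ((\<lambda>f. f [j]) \<circ> (\<lambda>\<omega>. \<lambda>js\<in>{[j]}. X js \<omega>))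
      borel (cascade b (\<lambda>js f. f (j # js)) n \<circ> (\<lambda>\<omega>. \<lambda>js\<in>branch_words j n. X js \<omega>))"
    using measurable_evaluation_cascade[of "(#) j" n] by (auto simp: branch_words_def)
  then show ?thesis
    by (simp add: comp_def subcascade_factors[OF order_refl, symmetric])
qed

lemma indep_branches:
  assumes ij: "i < b" "j < b" "i \<noteq> j"
  shows "indep_var borel (branch i n) borel (branch j n)"
proof -
  define K where "K j = insert [j] (branch_words j n)" for j
  define F where "F j f = f [j] * cascade b (\<lambda>js f. f (j # js)) n f" for j and f :: "nat list \<Rightarrow> real"
  have F: "F j \<in> borel_measurable (Pi\<^sub>M (K j) (\<lambda>_. borel))" for j
    unfolding F_def
    by (intro borel_measurable_times measurable_evaluation_cascade measurable_component_singleton)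
       (auto simp: K_def branch_words_def)
  have branch_eq: "F j (\<lambda>js\<in>K j. X js \<omega>) = branch j n \<omega>" for j \<omega>
    using subcascade_factors[of j n "K j" \<omega>] by (simp add: F_def branch_def K_def subset_insertI)
  have "K i \<inter> K j = {}"
    using ij(3) by (auto simp: K_def branch_words_def)
  then have "indep_var (Pi\<^sub>M (K i) (\<lambda>_. borel)) (\<lambda>\<omega>. \<lambda>js\<in>K i. X js \<omega>)
      (Pi\<^sub>M (K j) (\<lambda>_. borel)) (\<lambda>\<omega>. \<lambda>js\<in>K j. X js \<omega>)"
    using branch_words_subset single_in_words ij
    by (intro indep_var_restrict[OF indep]) (auto simp: K_def)
  from indep_var_compose[OF this F F] show ?thesis
    by (simp add: comp_def branch_eq)
qed

lemma subcascade_measurable: "j < b \<Longrightarrow> subcascade j n \<in> borel_measurable M"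
  using indep_weight_subcascade by (auto dest: indep_var_rv2)

lemma branch_measurable: "j < b \<Longrightarrow> branch j n \<in> borel_measurable M"
  unfolding branch_def using subcascade_measurable[of j n] by measurable

lemma cascade_measurable: "cascade b X n \<in> borel_measurable M"
proof (cases n)
  case (Suc k)
  have "(\<lambda>\<omega>. (\<Sum>j<b. branch j k \<omega>) / real b) \<in> borel_measurable M"
    using branch_measurable by (intro borel_measurable_divide borel_measurable_sum) auto
  then show ?thesis by (simp add: Suc cascade_Suc_branch[abs_def])
qed simp

section \<open>Moments of the cascade\<close>

definition weight_moment :: "real \<Rightarrow> real" where
  "weight_moment p = expectation (\<lambda>\<omega>. X [0] \<omega> powr p)"

definition moment :: "nat \<Rightarrow> real \<Rightarrow> real" where
  "moment n p = expectation (\<lambda>\<omega>. cascade b X n \<omega> powr p)"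

lemma moment_0 [simp]: "moment 0 p = 1"
  by (simp add: moment_def prob_space)

lemma moment_nonneg: "0 \<le> moment n p" "0 \<le> weight_moment p"
  by (simp_all add: moment_def weight_moment_def)

lemma powr_moment_cong_distr:
  fixes A B :: "'b \<Rightarrow> real" and p :: real
  assumes "distr M borel A = distr M borel B" and "A \<in> borel_measurable M" "B \<in> borel_measurable M"
  shows "integrable M (\<lambda>\<omega>. A \<omega> powr p) \<longleftrightarrow> integrable M (\<lambda>\<omega>. B \<omega> powr p)"
    and "expectation (\<lambda>\<omega>. A \<omega> powr p) = expectation (\<lambda>\<omega>. B \<omega> powr p)"
proof -
  have powr: "(\<lambda>x. x powr p) \<in> borel_measurable (borel :: real measure)" by measurable
  show "integrable M (\<lambda>\<omega>. A \<omega> powr p) \<longleftrightarrow> integrable M (\<lambda>\<omega>. B \<omega> powr p)"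
    using integrable_distr_eq[OF assms(2) powr] integrable_distr_eq[OF assms(3) powr] assms(1) by simp
  show "expectation (\<lambda>\<omega>. A \<omega> powr p) = expectation (\<lambda>\<omega>. B \<omega> powr p)"
    using integral_distr[OF assms(2) powr] integral_distr[OF assms(3) powr] assms(1) by simp
qed

lemma integrable_powr_mono:
  fixes f :: "'b \<Rightarrow> real" and p r :: real
  assumes f: "f \<in> borel_measurable M" "\<And>\<omega>. 0 \<le> f \<omega>"
    and int: "integrable M (\<lambda>\<omega>. f \<omega> powr p)" and r: "0 \<le> r" "r \<le> p"
  shows "integrable M (\<lambda>\<omega>. f \<omega> powr r)"
proof (rule Bochner_Integration.integrable_bound)
  show "integrable M (\<lambda>\<omega>. 1 + f \<omega> powr p)" using int by simp
  show "(\<lambda>\<omega>. f \<omega> powr r) \<in> borel_measurable M" using f(1) by measurable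
  have "x powr r \<le> 1 + x powr p" if "0 \<le> x" for x :: real
  proof (cases "x \<le> 1")
    case True
    then have "x powr r \<le> 1" using that r by (intro powr_le1) auto
    then show ?thesis by (simp add: add_increasing2)
  next
    case False
    then have "x powr r \<le> x powr p" using r by (intro powr_mono) auto
    then show ?thesis by simp
  qed
  then show "AE \<omega> in M. norm (f \<omega> powr r) \<le> norm (1 + f \<omega> powr p)"
    using f(2) by simp
qed

lemma branch_moment:
  assumes j: "j < b" and W: "integrable M (\<lambda>\<omega>. X [0] \<omega> powr p)"
    and Y: "integrable M (\<lambda>\<omega>. cascade b X n \<omega> powr p)"
  shows "integrable M (\<lambda>\<omega>. branch j n \<omega> powr p)"
    and "expectation (\<lambda>\<omega>. branch j n \<omega> powr p) = weight_moment p * moment n p"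
proof -
  have "indep_var borel ((\<lambda>x. x powr p) \<circ> X [j]) borel ((\<lambda>x. x powr p) \<circ> subcascade j n)"
    by (intro indep_var_compose[OF indep_weight_subcascade[OF j]]) measurable
  then have ind: "indep_var borel (\<lambda>\<omega>. X [j] \<omega> powr p) borel (\<lambda>\<omega>. subcascade j n \<omega> powr p)"
    by (simp add: comp_def)
  have "distr M borel (X [j]) = distr M borel (X [0])"
    using j by (intro law[of 1]) (auto simp: words_def)
  note Xj = powr_moment_cong_distr[OF this single_measurable[OF j] single_measurable, of p]
  note Yj = powr_moment_cong_distr[OF distr_subcascade[OF j] subcascade_measurable[OF j]
      cascade_measurable, of n p]
  have int: "integrable M (\<lambda>\<omega>. X [j] \<omega> powr p)" "integrable M (\<lambda>\<omega>. subcascade j n \<omega> powr p)"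
    using W Y Xj(1) Yj(1) b by auto
  have eq: "branch j n \<omega> powr p = X [j] \<omega> powr p * subcascade j n \<omega> powr p" for \<omega>
    by (simp add: branch_def powr_mult nonneg subcascade_nonneg)
  show "integrable M (\<lambda>\<omega>. branch j n \<omega> powr p)"
    unfolding eq by (rule indep_var_integrable[OF ind int])
  show "expectation (\<lambda>\<omega>. branch j n \<omega> powr p) = weight_moment p * moment n p"
    unfolding eq indep_var_lebesgue_integral[OF ind int]
    using Xj(2) Yj(2) b by (simp add: weight_moment_def moment_def)
qed

lemma weight_integrable: "integrable M (X [0])"
  using mean not_integrable_integral_eq by fastforce

lemma mean_cascade: "integrable M (cascade b X n) \<and> expectation (cascade b X n) = 1"
proof (induction n)
  case (Suc n)
  have br: "integrable M (branch j n)" "expectation (branch j n) = 1" if "j < b" for j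
    using branch_moment[OF that, of 1 n] weight_integrable mean Suc
    by (simp_all add: weight_moment_def moment_def nonneg cascade_nonneg branch_nonneg)
  then have "integrable M (\<lambda>\<omega>. \<Sum>j<b. branch j n \<omega>)"
      "expectation (\<lambda>\<omega>. \<Sum>j<b. branch j n \<omega>) = real b"
    by (auto intro!: Bochner_Integration.integrable_sum simp: Bochner_Integration.integral_sum)
  then show ?case
    using b by (simp add: cascade_Suc_branch[abs_def])
qed (simp add: prob_space)

lemma mean_branch:
  assumes "j < b"
  shows "integrable M (branch j n)" "expectation (branch j n) = 1"
  using branch_moment[OF assms, of 1 n] weight_integrable mean mean_cascade[of n]
  by (simp_all add: weight_moment_def moment_def nonneg cascade_nonneg branch_nonneg)

text \<open>
  The factor with exponent 1 has mean 1 and disappears by independence.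
\<close>

lemma cross_moment:
  assumes ij: "i < b" "j < b" "i \<noteq> j" and int: "integrable M (\<lambda>\<omega>. branch j n \<omega> powr r)"
  shows "integrable M (\<lambda>\<omega>. branch i n \<omega> * branch j n \<omega> powr r)"
    and "expectation (\<lambda>\<omega>. branch i n \<omega> * branch j n \<omega> powr r) = expectation (\<lambda>\<omega>. branch j n \<omega> powr r)"
proof -
  have "indep_var borel ((\<lambda>x. x) \<circ> branch i n) borel ((\<lambda>x. x powr r) \<circ> branch j n)"
    by (intro indep_var_compose[OF indep_branches[OF ij]]) measurable
  then have ind: "indep_var borel (branch i n) borel (\<lambda>\<omega>. branch j n \<omega> powr r)"
    by (simp add: comp_def)
  show "integrable M (\<lambda>\<omega>. branch i n \<omega> * branch j n \<omega> powr r)"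
    by (rule indep_var_integrable[OF ind mean_branch(1)[OF ij(1)] int])
  show "expectation (\<lambda>\<omega>. branch i n \<omega> * branch j n \<omega> powr r) = expectation (\<lambda>\<omega>. branch j n \<omega> powr r)"
    using indep_var_lebesgue_integral[OF ind mean_branch(1)[OF ij(1)] int] mean_branch(2)[OF ij(1)]
    by simp
qed

context
  fixes p :: real
  assumes p: "1 \<le> p" and W: "integrable M (\<lambda>\<omega>. X [0] \<omega> powr p)"
begin

definition cross_sum :: "nat \<Rightarrow> 'b \<Rightarrow> real" where
  "cross_sum n \<omega> = (\<Sum>j<b. \<Sum>i\<in>{..<b} - {j}. branch i n \<omega> * branch j n \<omega> powr (p - 1))"

lemma branch_sums:
  assumes Y: "integrable M (\<lambda>\<omega>. cascade b X n \<omega> powr p)"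
  shows "integrable M (\<lambda>\<omega>. \<Sum>j<b. branch j n \<omega> powr p)"
    and "expectation (\<lambda>\<omega>. \<Sum>j<b. branch j n \<omega> powr p) = real b * (weight_moment p * moment n p)"
    and "integrable M (cross_sum n)"
    and "expectation (cross_sum n)
      = real b * (real b - 1) * (weight_moment (p - 1) * moment n (p - 1))"
proof -
  note br = branch_moment[OF _ W Y]
  show "integrable M (\<lambda>\<omega>. \<Sum>j<b. branch j n \<omega> powr p)"
    using br(1) by (intro Bochner_Integration.integrable_sum) auto
  show "expectation (\<lambda>\<omega>. \<Sum>j<b. branch j n \<omega> powr p) = real b * (weight_moment p * moment n p)"
    using br by (subst Bochner_Integration.integral_sum) auto
  have W': "integrable M (\<lambda>\<omega>. X [0] \<omega> powr (p - 1))"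
    using p b by (intro integrable_powr_mono[OF _ _ W] nonneg) auto
  have Y': "integrable M (\<lambda>\<omega>. cascade b X n \<omega> powr (p - 1))"
    using p by (intro integrable_powr_mono[OF _ _ Y] cascade_nonneg cascade_measurable) auto
  note br' = branch_moment[OF _ W' Y']
  note cr = cross_moment[OF _ _ _ br'(1)]
  show "integrable M (cross_sum n)"
    unfolding cross_sum_def using cr(1) by (intro Bochner_Integration.integrable_sum) auto
  have "expectation (cross_sum n)
      = (\<Sum>j<b. expectation (\<lambda>\<omega>. \<Sum>i\<in>{..<b} - {j}. branch i n \<omega> * branch j n \<omega> powr (p - 1)))"
    unfolding cross_sum_def
    using cr(1) by (intro Bochner_Integration.integral_sum Bochner_Integration.integrable_sum) auto
  also have "\<dots> = (\<Sum>j<b. \<Sum>i\<in>{..<b} - {j}. expectation (\<lambda>\<omega>. branch i n \<omega> * branch j n \<omega> powr (p - 1)))"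
    using cr(1) by (intro sum.cong refl Bochner_Integration.integral_sum) auto
  also have "\<dots> = (\<Sum>j<b. \<Sum>i\<in>{..<b} - {j}. weight_moment (p - 1) * moment n (p - 1))"
    using cr(2) br'(2) by (intro sum.cong refl) auto
  also have "\<dots> = real b * (real b - 1) * (weight_moment (p - 1) * moment n (p - 1))"
    using b by (simp add: of_nat_diff)
  finally show "expectation (cross_sum n)
      = real b * (real b - 1) * (weight_moment (p - 1) * moment n (p - 1))" .
qed

lemma cascade_powr_integrable: "integrable M (\<lambda>\<omega>. cascade b X n \<omega> powr p)"
proof (induction n)
  case (Suc n)
  let ?R = "\<lambda>\<omega>. (\<Sum>j<b. branch j n \<omega> powr p) + p * real b powr (p - 1) * cross_sum n \<omega>"
  have "integrable M (\<lambda>\<omega>. (\<Sum>j<b. branch j n \<omega>) powr p)"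
  proof (rule Bochner_Integration.integrable_bound)
    show "integrable M ?R" using branch_sums[OF Suc] by simp
    have "(\<lambda>\<omega>. \<Sum>j<b. branch j n \<omega>) \<in> borel_measurable M"
      using branch_measurable by (intro borel_measurable_sum) auto
    then show "(\<lambda>\<omega>. (\<Sum>j<b. branch j n \<omega>) powr p) \<in> borel_measurable M"
      by measurable
    have "(\<Sum>j<b. branch j n \<omega>) powr p \<le> ?R \<omega>" for \<omega>
      using powr_sum_le_cross[of "{..<b}" "\<lambda>j. branch j n \<omega>" p] branch_nonneg p
      by (simp add: cross_sum_def)
    then show "AE \<omega> in M. norm ((\<Sum>j<b. branch j n \<omega>) powr p) \<le> norm (?R \<omega>)"
      by (intro AE_I2) (metis abs_of_nonneg order_trans powr_ge_zero real_norm_def)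
  qed
  then show ?case
    by (simp add: cascade_Suc_branch powr_divide branch_nonneg sum_nonneg)
qed simp

lemma moment_Suc_eq:
  "moment (Suc n) p = expectation (\<lambda>\<omega>. (\<Sum>j<b. branch j n \<omega>) powr p) / real b powr p"
  by (simp add: moment_def cascade_Suc_branch powr_divide branch_nonneg sum_nonneg)

lemma branch_sum_powr_integrable: "integrable M (\<lambda>\<omega>. (\<Sum>j<b. branch j n \<omega>) powr p)"
  using integrable_mult_right[OF cascade_powr_integrable[of "Suc n"], of "real b powr p"] b
  by (simp add: cascade_Suc_branch powr_divide branch_nonneg sum_nonneg)

lemma moment_Suc_le:
  "moment (Suc n) p \<le> real b powr (1 - p) * weight_moment p * moment n p
    + p * (real b - 1) * weight_moment (p - 1) * moment n (p - 1)"
proof -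
  note sums = branch_sums[OF cascade_powr_integrable, of n]
  have "expectation (\<lambda>\<omega>. (\<Sum>j<b. branch j n \<omega>) powr p)
      \<le> expectation (\<lambda>\<omega>. (\<Sum>j<b. branch j n \<omega> powr p) + p * real b powr (p - 1) * cross_sum n \<omega>)"
  proof (intro integral_mono branch_sum_powr_integrable)
    show "(\<Sum>j<b. branch j n \<omega>) powr p
        \<le> (\<Sum>j<b. branch j n \<omega> powr p) + p * real b powr (p - 1) * cross_sum n \<omega>" for \<omega>
      using powr_sum_le_cross[of "{..<b}" "\<lambda>j. branch j n \<omega>" p] branch_nonneg p
      by (simp add: cross_sum_def)
  qed (use sums in simp)
  also have "\<dots> = real b * (weight_moment p * moment n p) + p * real b powr (p - 1) *
      (real b * (real b - 1) * (weight_moment (p - 1) * moment n (p - 1)))"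
    using sums by simp
  finally have "moment (Suc n) p \<le> \<dots> / real b powr p"
    unfolding moment_Suc_eq by (rule divide_right_mono) simp
  also have "\<dots> = real b powr (1 - p) * weight_moment p * moment n p
    + p * (real b - 1) * weight_moment (p - 1) * moment n (p - 1)"
    using b by (simp add: powr_diff field_simps)
  finally show ?thesis .
qed

lemma moment_Suc_ge:
  assumes "2 \<le> p"
  shows "real b powr (1 - p) * weight_moment p * moment n p
    + real b powr (1 - p) * (real b - 1) * weight_moment (p - 1) * moment n (p - 1)
    \<le> moment (Suc n) p"
proof -
  note sums = branch_sums[OF cascade_powr_integrable, of n]
  have "real b powr (1 - p) * weight_moment p * moment n p
    + real b powr (1 - p) * (real b - 1) * weight_moment (p - 1) * moment n (p - 1)
    = (real b * (weight_moment p * moment n p) +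
      real b * (real b - 1) * (weight_moment (p - 1) * moment n (p - 1))) / real b powr p"
    using b by (simp add: powr_diff field_simps)
  also have "real b * (weight_moment p * moment n p) +
      real b * (real b - 1) * (weight_moment (p - 1) * moment n (p - 1))
    = expectation (\<lambda>\<omega>. (\<Sum>j<b. branch j n \<omega> powr p) + cross_sum n \<omega>)"
    using sums by simp
  also have "\<dots> \<le> expectation (\<lambda>\<omega>. (\<Sum>j<b. branch j n \<omega>) powr p)"
  proof (intro integral_mono branch_sum_powr_integrable)
    show "(\<Sum>j<b. branch j n \<omega> powr p) + cross_sum n \<omega> \<le> (\<Sum>j<b. branch j n \<omega>) powr p" for \<omega>
      using powr_sum_ge_cross[of "{..<b}" "\<lambda>j. branch j n \<omega>" p] branch_nonneg assms
      by (simp add: cross_sum_def)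
  qed (use sums in simp)
  also have "\<dots> / real b powr p = moment (Suc n) p"
    by (simp add: moment_Suc_eq)
  finally show ?thesis by (simp add: divide_right_mono)
qed

lemma branch_moment_ge: "2 powr (- p) \<le> weight_moment p * moment n p"
proof -
  have zero: "0 < b" using b by simp
  note br = branch_moment[OF zero W cascade_powr_integrable, of n]
  have "1 = expectation (branch 0 n)"
    using mean_branch[OF zero] by simp
  also have "\<dots> \<le> expectation (\<lambda>\<omega>. 1 / 2 + 2 powr (p - 1) * branch 0 n \<omega> powr p)"
    using br mean_branch[OF zero] by (intro integral_mono le_half_add_powr branch_nonneg p) auto
  also have "\<dots> = 1 / 2 + 2 powr (p - 1) * (weight_moment p * moment n p)"
    using br by (simp add: prob_space)
  finally show ?thesis by (simp add: powr_diff powr_minus field_simps)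
qed

text \<open>
  In \<open>moment_Suc_le\<close> the coefficient \<open>\<rho>\<close> of the \<open>p\<close>-th moment is below 1. The \<open>(p - 1)\<close>-th moment
  in the cross terms is absorbed by \<open>powr_le_add_powr\<close>, with \<open>\<delta>\<close> chosen so that the coefficient
  rises only to \<open>(1 + \<rho>) / 2 < 1\<close>.
\<close>

lemma moment_bounded_if_subcritical:
  assumes sub: "weight_moment p < real b powr (p - 1)"
  shows "\<exists>K. \<forall>n. moment n p \<le> K"
proof -
  define \<rho> where "\<rho> = real b powr (1 - p) * weight_moment p"
  have \<rho>: "0 \<le> \<rho>" "\<rho> < 1"
  proof -
    show "0 \<le> \<rho>" by (simp add: \<rho>_def moment_nonneg)
    have "\<rho> < real b powr (1 - p) * real b powr (p - 1)"
      unfolding \<rho>_def using sub b by (intro mult_strict_left_mono) auto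
    then show "\<rho> < 1" using b by (simp add: powr_add[symmetric])
  qed
  \<comment> \<open>the summand 1 only makes \<open>C\<close> strictly positive, so that \<open>\<delta>\<close> may divide by it\<close>
  define C where "C = p * (real b - 1) * weight_moment (p - 1) + 1"
  have C: "0 < C" using p b by (simp add: C_def moment_nonneg add_nonneg_pos)
  define \<delta> where "\<delta> = (1 - \<rho>) / (2 * C)"
  have \<delta>: "0 < \<delta>" using \<rho> C by (simp add: \<delta>_def)
  define r where "r = (1 + \<rho>) / 2"
  have r: "0 \<le> r" "r < 1" using \<rho> by (auto simp: r_def)
  have r_eq: "\<rho> + C * \<delta> = r" using C by (simp add: r_def \<delta>_def field_simps)
  define D where "D = C * (1 / \<delta>) powr (p - 1)"
  have D: "0 \<le> D" using C by (simp add: D_def)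
  have step: "moment (Suc n) p \<le> r * moment n p + D" for n
  proof -
    have int: "integrable M (\<lambda>\<omega>. cascade b X n \<omega> powr (p - 1))"
      using p by (intro integrable_powr_mono[OF _ _ cascade_powr_integrable[of n]]
        cascade_nonneg cascade_measurable) auto
    have "moment n (p - 1)
        \<le> expectation (\<lambda>\<omega>. \<delta> * cascade b X n \<omega> powr p + (1 / \<delta>) powr (p - 1))"
      unfolding moment_def using int cascade_powr_integrable[of n]
      by (intro integral_mono powr_le_add_powr cascade_nonneg \<delta> p) auto
    also have "\<dots> = \<delta> * moment n p + (1 / \<delta>) powr (p - 1)"
      using cascade_powr_integrable[of n] by (simp add: moment_def prob_space)
    finally have "C * moment n (p - 1) \<le> C * (\<delta> * moment n p + (1 / \<delta>) powr (p - 1))"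
      using C by (intro mult_left_mono) auto
    moreover have "moment (Suc n) p \<le> \<rho> * moment n p + C * moment n (p - 1)"
      using moment_Suc_le[of n] moment_nonneg(1)[of n "p - 1"]
      by (simp add: C_def \<rho>_def distrib_right)
    ultimately have "moment (Suc n) p \<le> (\<rho> + C * \<delta>) * moment n p + D"
      by (simp add: D_def algebra_simps)
    then show ?thesis by (simp add: r_eq)
  qed
  have "moment n p \<le> 1 + D / (1 - r)" for n
  proof (induction n)
    case (Suc n)
    have "moment (Suc n) p \<le> r * (1 + D / (1 - r)) + D"
      using step[of n] mult_left_mono[OF Suc r(1)] by linarith
    also have "\<dots> = r + D / (1 - r)" using r by (simp add: field_simps)
    finally show ?case using r by simp
  qed (use r D in simp)
  then show ?thesis by blast
qed

end

section \<open>Linear growth at the critical exponent\<close>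

lemma critical_moment_linear_growth:
  assumes q: "2 \<le> q" and critical: "weight_moment q = real b powr (q - 1)"
    and sub: "2 < q \<Longrightarrow> weight_moment (q - 1) < real b powr (q - 2)"
  obtains c C where "0 < c" "\<And>n. c * real n \<le> moment n q" "\<And>n. moment n q \<le> 1 + C * real n" "0 \<le> C"
proof -
  have W: "integrable M (\<lambda>\<omega>. X [0] \<omega> powr q)"
    using critical b not_integrable_integral_eq unfolding weight_moment_def by fastforce
  have W': "integrable M (\<lambda>\<omega>. X [0] \<omega> powr (q - 1))"
    using q b by (intro integrable_powr_mono[OF _ _ W] nonneg) auto
  have one: "real b powr (1 - q) * weight_moment q = 1"
    using b by (simp add: critical powr_add[symmetric])
  obtain K where K: "\<And>n. moment n (q - 1) \<le> K"
  proof (cases "q = 2")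
    case True
    have "moment n (q - 1) \<le> 1" for n
      using mean_cascade[of n] by (simp add: True moment_def cascade_nonneg)
    then show ?thesis using that by blast
  next
    case False
    then show ?thesis
      using moment_bounded_if_subcritical[OF _ W'] sub q that by force
  qed
  have "0 \<le> K" using K[of 0] by simp
  define C where "C = q * (real b - 1) * weight_moment (q - 1) * K"
  define c where "c = real b powr (1 - q) * (real b - 1) * 2 powr (1 - q)"
  show ?thesis
  proof
    show "0 < c" using b by (simp add: c_def)
    show "0 \<le> C" using b q \<open>0 \<le> K\<close> by (simp add: C_def moment_nonneg)
    show "c * real n \<le> moment n q" for n
    proof (induction n)
      case (Suc n)
      have "2 powr (1 - q) \<le> weight_moment (q - 1) * moment n (q - 1)"
        using branch_moment_ge[OF _ W', of n] q by simp
      then have "c \<le> real b powr (1 - q) * (real b - 1) * (weight_moment (q - 1) * moment n (q - 1))"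
        unfolding c_def using b by (intro mult_left_mono) auto
      then show ?case
        using moment_Suc_ge[OF _ W, of n] q Suc by (simp add: one mult.assoc distrib_left)
    qed simp
    show "moment n q \<le> 1 + C * real n" for n
    proof (induction n)
      case (Suc n)
      have "q * (real b - 1) * weight_moment (q - 1) * moment n (q - 1) \<le> C"
        unfolding C_def using K b q by (intro mult_left_mono) (auto simp: moment_nonneg)
      then show ?case
        using moment_Suc_le[OF _ W, of n] q Suc by (simp add: one distrib_left)
    qed simp
  qed
qed

end

text \<open>
  A multiplicative constant contributes a bounded term to the logarithm, which is negligible
  against \<open>ln n\<close>.
\<close>

lemma ln_linear_growth:
  fixes a :: "nat \<Rightarrow> real"
  assumes c: "0 < c" and lower: "\<And>n. c * real n \<le> a n"
    and C: "0 \<le> C" and upper: "\<And>n. a n \<le> 1 + C * real n"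
  shows "(\<lambda>n. ln (a n) / ln (real n)) \<longlonglongrightarrow> 1"
proof (rule tendsto_sandwich)
  show "(\<lambda>n. ln (c * real n) / ln (real n)) \<longlonglongrightarrow> 1"
    using c by real_asymp
  have "0 < 1 + C" using C by simp
  then show "(\<lambda>n. ln ((1 + C) * real n) / ln (real n)) \<longlonglongrightarrow> 1"
    by real_asymp
  show "\<forall>\<^sub>F n in sequentially. ln (c * real n) / ln (real n) \<le> ln (a n) / ln (real n)"
    using eventually_gt_at_top[of 1]
  proof eventually_elim
    case (elim n)
    with c have "0 < c * real n" by simp
    with lower[of n] show ?case using elim
      by (intro divide_right_mono ln_mono) auto
  qed
  show "\<forall>\<^sub>F n in sequentially. ln (a n) / ln (real n) \<le> ln ((1 + C) * real n) / ln (real n)"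
    using eventually_gt_at_top[of 1]
  proof eventually_elim
    case (elim n)
    with c have "0 < c * real n" by simp
    with lower[of n] have "0 < a n" by simp
    moreover have "a n \<le> (1 + C) * real n"
      using upper[of n] elim by (simp add: distrib_right)
    ultimately show ?case using elim
      by (intro divide_right_mono ln_mono) auto
  qed
qed

theorem theorem1p2:
  fixes b :: nat and q :: real
    and N :: "'a measure" and W :: "'a \<Rightarrow> real"
    and M :: "'b measure" and X :: "nat list \<Rightarrow> 'b \<Rightarrow> real"
  assumes b: "b \<ge> 2"
    and N: "prob_space N"
    and W_rv: "W \<in> borel_measurable N"
    and W_nonneg: "AE \<omega> in N. W \<omega> \<ge> 0"
    and W_mean: "prob_space.expectation N W = 1"
    and W_not_TC: "distr N borel W \<noteq> W_TC_law b"
    and M: "prob_space M"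
    and X_indep: "prob_space.indep_vars M (\<lambda>_. borel) X (\<Union>m\<in>{1..}. words b m)"
    and X_law: "\<And>m js. m \<ge> 1 \<Longrightarrow> js \<in> words b m \<Longrightarrow> distr M borel (X js) = distr N borel W"
    and q: "q \<ge> 2"
    and W_moment: "prob_space.expectation N (\<lambda>\<omega>. W \<omega> powr q) = real b powr (q - 1)"
  shows "((\<lambda>n. ln (prob_space.expectation M (\<lambda>\<omega>. cascade b X n \<omega> powr q)) / ln (real n))
           \<longlongrightarrow> 1) sequentially"
proof -
  interpret N: prob_space N by (rule N)
  interpret M: prob_space M by (rule M)
  \<comment> \<open>the positive parts are non-negative everywhere and almost surely equal to the weights\<close>
  define X' where "X' js \<omega> = max 0 (X js \<omega>)" for js \<omega>
  have X_rv: "X js \<in> borel_measurable M" if "1 \<le> m" "js \<in> words b m" for m js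
    using X_indep that by (auto simp: M.indep_vars_def)
  have X'_law: "distr M borel (X' js) = distr N borel W" if js: "1 \<le> m" "js \<in> words b m" for m js
  proof -
    have "distr M borel (X' js) = distr (distr M borel (X js)) borel (max 0)"
      using X_rv[OF js] by (subst distr_distr) (auto simp: comp_def X'_def[abs_def])
    also have "\<dots> = distr N borel (\<lambda>\<omega>. max 0 (W \<omega>))"
      using W_rv by (subst X_law[OF js], subst distr_distr) (auto simp: comp_def)
    also have "\<dots> = distr N borel W"
      using W_rv W_nonneg by (intro distr_cong_AE) (auto elim: eventually_mono)
    finally show ?thesis .
  qed
  have root: "[0] \<in> words b 1" using b by (auto simp: words_def)
  have X'_rv: "X' [0] \<in> borel_measurable M"
    unfolding X'_def using X_rv[OF _ root] by measurable
  have transfer: "M.expectation (\<lambda>\<omega>. g (X' [0] \<omega>)) = N.expectation (\<lambda>\<omega>. g (W \<omega>))"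
    if g: "g \<in> borel_measurable borel" for g :: "real \<Rightarrow> real"
    using integral_distr[OF X'_rv g] integral_distr[OF W_rv g] X'_law[OF _ root] by simp
  interpret nonneg_cascade M b X'
  proof
    show "2 \<le> b" by (rule b)
    show "M.indep_vars (\<lambda>_. borel) X' (\<Union>m\<in>{1..}. words b m)"
      unfolding X'_def by (rule M.indep_vars_compose2[OF X_indep]) auto
    show "distr M borel (X' js) = distr M borel (X' [0])" if "1 \<le> m" "js \<in> words b m" for m js
      using X'_law[OF that] X'_law[OF _ root] by simp
    show "0 \<le> X' js \<omega>" for js \<omega> by (simp add: X'_def)
    show "M.expectation (X' [0]) = 1" using transfer[of "\<lambda>x. x"] W_mean by simp
  qed
  have weight: "weight_moment p = N.expectation (\<lambda>\<omega>. W \<omega> powr p)" for p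
    unfolding weight_moment_def by (rule transfer) measurable
  have "weight_moment q = real b powr (q - 1)"
    by (simp add: weight W_moment)
  moreover have "weight_moment (q - 1) < real b powr (q - 2)" if "2 < q"
    unfolding weight using b
    by (intro N.moment_below_critical[OF _ W_rv W_nonneg W_mean W_not_TC that W_moment]) auto
  ultimately obtain c C where growth: "0 < c" "\<And>n. c * real n \<le> moment n q"
      "\<And>n. moment n q \<le> 1 + C * real n" "0 \<le> C"
    using critical_moment_linear_growth[OF q] by blast
  have X_nonneg: "AE \<omega> in M. 0 \<le> X js \<omega>" if js: "1 \<le> m" "js \<in> words b m" for m js
  proof -
    have "AE x in distr M borel (X js). 0 \<le> x"
      unfolding X_law[OF js] using W_nonneg W_rv by (subst AE_distr_iff) auto
    then show ?thesis using X_rv[OF js] by (subst (asm) AE_distr_iff) auto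
  qed
  have "moment n q = M.expectation (\<lambda>\<omega>. cascade b X n \<omega> powr q)" for n
  proof -
    have "AE \<omega> in M. \<forall>m\<in>{1..n}. \<forall>js\<in>words b m. 0 \<le> X js \<omega>"
      using X_nonneg by (intro AE_finite_allI) auto
    then have eq: "AE \<omega> in M. cascade b X' n \<omega> = cascade b X n \<omega>"
      by eventually_elim (auto intro!: cascade_cong simp: X'_def)
    have "cascade b X n \<in> borel_measurable M"
      unfolding cascade_def using X_rv take_in_words
      by (intro borel_measurable_divide borel_measurable_sum borel_measurable_prod) fastforce+
    with eq show ?thesis
      unfolding moment_def using cascade_measurable[of n]
      by (intro integral_cong_AE) auto
  qed
  with ln_linear_growth[of c "\<lambda>n. moment n q" C] growth show ?thesis by simp
qed

end
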